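(* Consider the system $\dot x=f(x)+Bu$ with initial state $x(0)=x_0\in\mathbb{R}^n$ (no disturbance, $w\equiv0$), where $f:\mathbb{R}^n\to\mathbb{R}^n$ is $C^2$ with $f(0)=0$. Let (i) all second-order partial derivatives of $f$ be bounded on $\mathbb{R}^n$; (ii) $B$ be a regular (square, invertible) real $n\times n$ matrix. Then the system is globally null controllable in the following sense: for every $T>0$ and every $\mu>0$ there exist $\Gamma_0>\|A\|$ and $\omega>0$ for which one may take $\varepsilon(T,\Gamma_0,\omega)=\mu$, and a gain matrix $K\in\mathbb{R}^{n\times n}$, such that under the bounded continuous state feedback control law $$u=v_\omega(x,t)=\left(\frac{1}{T-t}\right)\frac{Kx}{\omega}$$ on $[0,T]$, the solution with $x(0)=x_0$ satisfies $x(T)=0$ for all $x_0$ with $|x_0|<\mu$.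
   Context: $A=(\partial f/\partial x)(0)$ is the Jacobian matrix of $f$ at $0$, $|\cdot|$ is the Euclidean norm and $\|\cdot\|$ the induced (spectral) matrix norm. It is assumed that trajectories of the system exist at least on $[0,T]$ for every $x_0$ and every continuous input $u$. The control is unconstrained. Let $R_2(a)=f(a)-f(0)-Aa$ be the Taylor remainder. For $T>0$, $\Gamma_0>\|A\|$, $\omega>0$, $\varepsilon=\varepsilon(T,\Gamma_0,\omega)>0$ denotes a radius such that $$\left|T\omega e^{-\omega\tau}R_2(a)-Aa\right|\le\Gamma_0|a|\quad\text{for all }|a|\le\varepsilon,\ \tau\ge0.$$ The control law is considered along the closed-loop solution $x(t)$: "bounded continuous on $[0,T]$" means that $t\mapsto\frac{1}{T-t}\frac{Kx(t)}{\omega}$ is bounded and continuous, its value at $t=T$ (and that of $x$) being understood as the limit $t\to T^-$. *)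

theory Defs
  imports "HOL-Analysis.Analysis"
begin

text \<open>
  In finite dimension, continuity of the derivative in operator norm is the same as continuity of
  each directional evaluation \<open>a \<mapsto> Df(a) v\<close>; stating it for every direction \<open>v\<close> lets the second
  derivative be obtained by iterating the same predicate.
\<close>

definition C1 :: "('a::euclidean_space \<Rightarrow> 'b::euclidean_space) \<Rightarrow> bool" where
  "C1 g \<longleftrightarrow> (\<forall>a. g differentiable (at a)) \<and>
     (\<forall>v. continuous_on UNIV (\<lambda>a. frechet_derivative g (at a) v))"

definition C2 :: "('a::euclidean_space \<Rightarrow> 'b::euclidean_space) \<Rightarrow> bool" where
  "C2 g \<longleftrightarrow> C1 g \<and> (\<forall>v. C1 (\<lambda>a. frechet_derivative g (at a) v))"

definition partial_deriv ::
    "'n::finite \<Rightarrow> (real ^ 'n \<Rightarrow> real) \<Rightarrow> real ^ 'n \<Rightarrow> real" where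
  "partial_deriv i g a = deriv (\<lambda>s. g (a + s *\<^sub>R axis i 1)) 0"

definition bounded_second_partials :: "(real ^ 'n \<Rightarrow> real ^ 'm) \<Rightarrow> bool" where
  "bounded_second_partials f \<longleftrightarrow>
     (\<forall>i j k. bounded (range (partial_deriv i (partial_deriv j (\<lambda>a. f a $ k)))))"

definition taylor_remainder :: "(real ^ 'n \<Rightarrow> real ^ 'n) \<Rightarrow> real ^ 'n \<Rightarrow> real ^ 'n" where
  "taylor_remainder f a = f a - f 0 - jacobian f (at 0) *v a"

text \<open>
  \<open>\<epsilon>\<close> is a possible choice of the radius \<open>\<epsilon>(T, \<Gamma>\<^sub>0, \<omega>)\<close>.
\<close>

definition admissible_radius ::
    "(real ^ 'n \<Rightarrow> real ^ 'n) \<Rightarrow> real \<Rightarrow> real \<Rightarrow> real \<Rightarrow> real \<Rightarrow> bool" where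
  "admissible_radius f T \<Gamma>\<^sub>0 \<omega> \<epsilon> \<longleftrightarrow> \<epsilon> > 0 \<and>
     (\<forall>a \<tau>. norm a \<le> \<epsilon> \<longrightarrow> \<tau> \<ge> 0 \<longrightarrow>
        norm ((T * \<omega> * exp (- \<omega> * \<tau>)) *\<^sub>R taylor_remainder f a - jacobian f (at 0) *v a)
          \<le> \<Gamma>\<^sub>0 * norm a)"

text \<open>
  Solutions of \<open>x' = f(x) + B u(t)\<close>, \<open>x(0) = x0\<close> on a time interval \<open>S\<close> containing \<open>0\<close>;
  derivatives at endpoints belonging to \<open>S\<close> are one-sided.
\<close>

definition solves_on ::
    "(real ^ 'n \<Rightarrow> real ^ 'n) \<Rightarrow> real ^ 'm ^ 'n \<Rightarrow> (real \<Rightarrow> real ^ 'm) \<Rightarrow> real ^ 'n \<Rightarrow>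
      real set \<Rightarrow> (real \<Rightarrow> real ^ 'n) \<Rightarrow> bool" where
  "solves_on f B u x0 S x \<longleftrightarrow> x 0 = x0 \<and>
     (\<forall>t\<in>S. (x has_vector_derivative (f (x t) + B *v u t)) (at t within S))"

definition trajectories_exist ::
    "(real ^ 'n \<Rightarrow> real ^ 'n) \<Rightarrow> real ^ 'm ^ 'n \<Rightarrow> real \<Rightarrow> bool" where
  "trajectories_exist f B T \<longleftrightarrow>
     (\<forall>x0 u. continuous_on {0..T} u \<longrightarrow> (\<exists>x. solves_on f B u x0 {0..T} x))"

definition feedback_law ::
    "real ^ 'n ^ 'm \<Rightarrow> real \<Rightarrow> real \<Rightarrow> real ^ 'n \<Rightarrow> real \<Rightarrow> real ^ 'm" where
  "feedback_law K \<omega> T x t = (1 / (T - t)) *\<^sub>R ((1 / \<omega>) *\<^sub>R (K *v x))"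

text \<open>
  The feedback law is singular at \<open>t = T\<close> (where Isabelle's division by zero yields a meaningless
  \<open>0\<close>), so the closed-loop equation is required on \<open>[0, T)\<close> only, and values at \<open>T\<close> are expressed
  as limits from the left.
\<close>

definition closed_loop_solution ::
    "(real ^ 'n \<Rightarrow> real ^ 'n) \<Rightarrow> real ^ 'm ^ 'n \<Rightarrow> real ^ 'n ^ 'm \<Rightarrow> real \<Rightarrow> real \<Rightarrow> real ^ 'n \<Rightarrow>
      (real \<Rightarrow> real ^ 'n) \<Rightarrow> bool" where
  "closed_loop_solution f B K \<omega> T x0 x \<longleftrightarrow>
     solves_on f B (\<lambda>t. feedback_law K \<omega> T (x t) t) x0 {0..<T} x"

definition bounded_continuous_upto :: "real \<Rightarrow> (real \<Rightarrow> real ^ 'm) \<Rightarrow> bool" where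
  "bounded_continuous_upto T u \<longleftrightarrow>
     bounded (u ` {0..<T}) \<and> continuous_on {0..<T} u \<and> (\<exists>l. (u \<longlongrightarrow> l) (at_left T))"

end

theory Submission
  imports Defs
begin

text \<open>
  Since \<open>B\<close> is invertible, the gain \<open>K = -k \<omega> B\<inverse>\<close> turns the closed loop into
  \<open>x' = f(x) - k/(T - t) x\<close>, a field with a linear damping term that becomes infinitely strong
  at time \<open>T\<close>. As \<open>f\<close> is \<open>C\<^sup>1\<close> and vanishes at \<open>0\<close>, it satisfies \<open>|f(a)| \<le> L|a|\<close> on the ball of
  radius \<open>\<mu>\<close>. For \<open>k \<ge> LT + 2\<close> the damping beats this growth with enough room to spare that
  \<open>|x|\<^sup>2 / (T - t)\<^sup>4\<close> is nonincreasing, so \<open>|x(t)| \<le> ((T - t)/T)\<^sup>2 |x(0)|\<close> as long as \<open>x\<close> stays in the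
  ball; this bound in turn keeps \<open>x\<close> in the ball up to time \<open>T\<close> (\<open>trapped_quadratic_decay\<close>).
  The exponent \<open>2\<close> leaves a factor \<open>T - t\<close> after division by \<open>T - t\<close> in the feedback law, so the control
  is bounded and, like the state, tends to \<open>0\<close>.

  A closed-loop solution is constructed in the logarithmic time \<open>s = ln (T/(T - t))\<close>, which sends
  \<open>[0, T)\<close> to \<open>[0, \<infinity>)\<close> and makes the damping coefficient constant: the equation becomes
  \<open>d\<xi>/ds = T exp(-s) f(\<xi>) - k \<xi>\<close>. After composing \<open>f\<close> with the projection onto the ball, the right-hand
  side is globally Lipschitz, so Picard iteration solves it on the whole half-line
  (\<open>picard_lindelof_half_line\<close>), and the decay estimate shows that the projection never acts.

  Finally, \<open>\<Gamma>\<^sub>0\<close> may be chosen after \<open>\<mu>\<close> and \<open>\<omega>\<close>: the map that it has to dominate is bounded linearly on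
  the ball, so a large \<open>\<Gamma>\<^sub>0\<close> makes \<open>\<mu>\<close> an admissible radius for \<open>\<omega> = 1\<close>.
\<close>

section \<open>Lipschitz bounds for continuously differentiable maps\<close>

text \<open>
  \<open>C1\<close> controls the derivative direction by direction; on a compact ball the finitely many basis
  directions together bound its operator norm, and the ball is convex.
\<close>

lemma C1_lipschitz_on_cball:
  fixes g :: "'a::euclidean_space \<Rightarrow> 'b::euclidean_space"
  assumes "C1 g"
  obtains L where "L \<ge> 0"
    and "\<And>a b. \<lbrakk>a \<in> cball 0 r; b \<in> cball 0 r\<rbrakk> \<Longrightarrow> norm (g a - g b) \<le> L * norm (a - b)"
proof -
  define D where "D = (\<lambda>a. frechet_derivative g (at a))"
  have der: "(g has_derivative D a) (at a)" for a
    using assms unfolding C1_def D_def by (simp add: frechet_derivative_works)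
  have "\<exists>M. \<forall>a\<in>cball 0 r. norm (D a v) \<le> M" for v
  proof -
    have "continuous_on (cball 0 r) (\<lambda>a. D a v)"
      using assms unfolding C1_def D_def by (meson continuous_on_subset subset_UNIV)
    then have "bounded ((\<lambda>a. D a v) ` cball 0 r)"
      by (intro compact_imp_bounded compact_continuous_image) auto
    then show ?thesis by (auto simp: bounded_iff)
  qed
  then obtain M where M: "\<And>v a. a \<in> cball 0 r \<Longrightarrow> norm (D a v) \<le> M v" by metis
  define L where "L = max 0 (\<Sum>v\<in>Basis. M v)"
  have "onorm (D a) \<le> L" if "a \<in> cball 0 r" for a
  proof -
    have "onorm (D a) \<le> (\<Sum>v\<in>Basis. norm (D a v))"
      using der has_derivative_bounded_linear by (intro onorm_componentwise) blast
    also have "\<dots> \<le> (\<Sum>v\<in>Basis. M v)" by (intro sum_mono M that)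
    finally show ?thesis unfolding L_def by simp
  qed
  then have "norm (g a - g b) \<le> L * norm (a - b)" if "a \<in> cball 0 r" "b \<in> cball 0 r" for a b
    using that by (intro differentiable_bound[where S = "cball 0 r" and f' = D])
      (auto intro: has_derivative_at_withinI der)
  moreover have "L \<ge> 0" unfolding L_def by simp
  ultimately show thesis using that by blast
qed

section \<open>Global solutions of Lipschitz equations on the half-line\<close>

lemma integral_norm_bound_exp:
  fixes v :: "real \<Rightarrow> 'a::euclidean_space"
  assumes "c > 0" "s \<ge> 0" "M \<ge> 0" "continuous_on {0..s} v"
    and "\<And>r. r \<in> {0..s} \<Longrightarrow> norm (v r) \<le> M * exp (c * r)"
  shows "norm (integral {0..s} v) \<le> M / c * exp (c * s)"
proof -
  have I: "((\<lambda>r. M * exp (c * r)) has_integral (M / c * exp (c * s) - M / c * exp (c * 0))) {0..s}"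
    using assms(1,2)
    by (intro fundamental_theorem_of_calculus)
      (auto intro!: derivative_eq_intros simp flip: has_real_derivative_iff_has_vector_derivative)
  have "norm (integral {0..s} v) \<le> integral {0..s} (\<lambda>r. M * exp (c * r))"
    using assms(4,5) I
    by (intro integral_norm_bound_integral integrable_continuous_interval) (auto intro!: continuous_intros)
  also have "\<dots> \<le> M / c * exp (c * s)"
    unfolding integral_unique[OF I] using assms(1,3) by simp
  finally show ?thesis .
qed

text \<open>
  Bielecki's weighted norm gives a solution on all of \<open>[0, \<infinity>)\<close> at once, with no gluing of local
  solutions: writing \<open>\<xi>(s) = exp(c s) z(s)\<close> with \<open>z\<close> bounded and continuous, the integral operator acts on
  \<open>z\<close> as a contraction with constant \<open>L/c\<close> in the supremum norm. The equilibrium at \<open>0\<close> ensures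
  that the operator maps bounded functions to bounded functions.
\<close>

lemma picard_lindelof_half_line:
  fixes h :: "real \<Rightarrow> 'a::euclidean_space \<Rightarrow> 'a"
  assumes L: "L \<ge> 0"
    and cont: "\<And>z. continuous_on {0..} z \<Longrightarrow> continuous_on {0..} (\<lambda>s. h s (z s))"
    and lip: "\<And>s a b. s \<ge> 0 \<Longrightarrow> norm (h s a - h s b) \<le> L * norm (a - b)"
    and zero: "\<And>s. s \<ge> 0 \<Longrightarrow> h s 0 = 0"
  obtains \<xi> where "\<xi> 0 = x0"
    and "\<And>s. s \<ge> 0 \<Longrightarrow> (\<xi> has_vector_derivative h s (\<xi> s)) (at s within {0..})"
proof -
  define c where "c = 2 * L + 1"
  have c: "c > 0" "L / c \<le> 1/2" using L unfolding c_def by (auto simp: field_simps)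
  define v where "v z r = h r (exp (c * r) *\<^sub>R apply_bcontfun z r)" for z r
  define G where "G z s = exp (- c * s) *\<^sub>R (x0 + integral {0..s} (v z))" for z s
  have v_cont: "continuous_on {0..} (v z)" for z
    unfolding v_def
    by (intro cont continuous_intros continuous_on_apply_bcontfun)
  have v_diff: "norm (v z r - v w r) \<le> (L * dist z w) * exp (c * r)" if "r \<ge> 0" for z w r
  proof -
    have "norm (v z r - v w r) \<le> L * (exp (c * r) * norm (z r - w r))"
      using lip[OF that, of "exp (c * r) *\<^sub>R z r" "exp (c * r) *\<^sub>R w r"]
      unfolding v_def by (simp flip: scaleR_diff_right)
    also have "\<dots> \<le> L * (exp (c * r) * dist z w)"
      using dist_bounded[of z r w] L by (intro mult_left_mono) (auto simp: dist_norm)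
    finally show ?thesis by (simp add: mult_ac)
  qed
  have G_diff: "norm (G z s - G w s) \<le> 1/2 * dist z w" if "s \<ge> 0" for z w s
  proof -
    have sub: "continuous_on {0..s} (v z)" for z
      by (rule continuous_on_subset[OF v_cont]) auto
    have "norm (integral {0..s} (\<lambda>r. v z r - v w r)) \<le> L * dist z w / c * exp (c * s)"
      using v_diff[of _ z w] c L that by (intro integral_norm_bound_exp continuous_intros sub) auto
    moreover have "integral {0..s} (\<lambda>r. v z r - v w r) = integral {0..s} (v z) - integral {0..s} (v w)"
      by (intro integral_diff integrable_continuous_interval sub)
    moreover have "G z s - G w s = exp (- c * s) *\<^sub>R (integral {0..s} (v z) - integral {0..s} (v w))"
      by (simp add: G_def algebra_simps)
    ultimately have "norm (G z s - G w s) \<le> exp (- c * s) * (L * dist z w / c * exp (c * s))"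
      by (simp only: norm_scaleR abs_exp_cancel mult_left_mono exp_ge_zero)
    also have "\<dots> = (L / c) * dist z w" by (simp add: exp_minus field_simps)
    also have "\<dots> \<le> 1/2 * dist z w" using c by (intro mult_right_mono) auto
    finally show ?thesis .
  qed
  have v_0: "integral {0..s} (v 0) = 0" if "s \<ge> 0" for s
    using that zero by (subst integral_cong[where g = "\<lambda>_. 0"]) (auto simp: v_def)
  have G_deriv: "((\<lambda>s. x0 + integral {0..s} (v z)) has_vector_derivative v z s) (at s within {0..})"
    if "s \<ge> 0" for z s
  proof -
    have "((\<lambda>s. integral {0..s} (v z)) has_vector_derivative v z s) (at s within {0..s+1})"
      by (rule integral_has_vector_derivative)
        (use that in \<open>auto intro: continuous_on_subset[OF v_cont]\<close>)
    moreover have "at s within {0..s+1} = at s within {0..}"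
      by (rule at_within_nhd[where S = "{..<s+1}"]) auto
    ultimately show ?thesis by (auto intro!: derivative_eq_intros)
  qed
  have G_cont: "continuous_on {0..} (G z)" for z
    unfolding G_def
    by (intro continuous_intros continuous_on_vector_derivative[where f' = "v z"] G_deriv) auto
  \<comment> \<open>Bounded continuous functions live on all of \<open>\<real>\<close>, so values at negative times are frozen at \<open>0\<close>.\<close>
  have G_bcontfun: "(\<lambda>s. G z (max 0 s)) \<in> bcontfun" for z
  proof (rule bcontfun_normI)
    show "continuous_on UNIV (\<lambda>s. G z (max 0 s))"
      by (rule continuous_on_compose2[OF G_cont]) (auto intro: continuous_intros)
    show "norm (G z (max 0 s)) \<le> 1/2 * dist z 0 + norm x0" for s
    proof -
      have "norm (G 0 (max 0 s)) \<le> norm x0"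
        using c by (simp add: G_def v_0 mult_left_le_one_le)
      then show ?thesis
        using G_diff[of "max 0 s" z 0] norm_triangle_ineq[of "G z (max 0 s) - G 0 (max 0 s)" "G 0 (max 0 s)"]
        by simp
    qed
  qed
  define P where "P z = Bcontfun (\<lambda>s. G z (max 0 s))" for z
  have P: "apply_bcontfun (P z) s = G z (max 0 s)" for z s
    unfolding P_def using G_bcontfun by (simp add: Bcontfun_inverse)
  have "dist (P z) (P w) \<le> 1/2 * dist z w" for z w
  proof (rule dist_bound)
    show "dist (P z s) (P w s) \<le> 1/2 * dist z w" for s
      using G_diff[of "max 0 s" z w] by (simp add: P dist_norm)
  qed
  then have "\<exists>!z. P z = z"
    by (intro banach_fix_type[where c = "1/2"]) auto
  then obtain z where z: "P z = z" by auto
  define \<xi> where "\<xi> s = x0 + integral {0..s} (v z)" for s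
  have "v z s = h s (\<xi> s)" if "s \<ge> 0" for s
  proof -
    have "z s = exp (- c * s) *\<^sub>R \<xi> s"
      using P[of z s] that unfolding z G_def \<xi>_def by simp
    then show ?thesis by (simp add: v_def flip: exp_add)
  qed
  then show thesis
    using G_deriv[of _ z] by (intro that[of \<xi>]) (auto simp: \<xi>_def[abs_def])
qed

section \<open>Decay under singular damping\<close>

text \<open>
  The derivative of \<open>|x|\<^sup>2 / (T - t)\<^sup>4\<close> is at most \<open>2 |x|\<^sup>2 / (T - t)\<^sup>5\<close> times \<open>L(T - t) - k + 2\<close>, where
  \<open>L(T - t)\<close> comes from the growth of \<open>g\<close>, \<open>k\<close> from the damping and \<open>2\<close> from the weight.
\<close>

lemma quadratic_decay:
  fixes x :: "real \<Rightarrow> 'a::euclidean_space"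
  assumes "0 \<le> s" "s < T" and k: "k \<ge> L * T + 2" and "L \<ge> 0"
    and ode: "\<And>t. t \<in> {0..s} \<Longrightarrow>
      (x has_vector_derivative g t - (k / (T - t)) *\<^sub>R x t) (at t within {0..s})"
    and g: "\<And>t. t \<in> {0..s} \<Longrightarrow> norm (g t) \<le> L * norm (x t)"
  shows "norm (x s) \<le> ((T - s) / T)\<^sup>2 * norm (x 0)"
proof -
  have T: "T > 0" using assms by simp
  define W where "W t = (x t \<bullet> x t) / (T - t) ^ 4" for t
  have "W s \<le> W 0"
  proof (rule DERIV_nonpos_imp_decreasing_open[OF \<open>0 \<le> s\<close>])
    have "continuous_on {0..s} x"
      using ode by (rule continuous_on_vector_derivative)
    then show "continuous_on {0..s} W"
      unfolding W_def using \<open>s < T\<close> by (intro continuous_intros) auto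
  next
    fix t assume t: "0 < t" "t < s"
    define d where "d = T - t"
    have d: "d > 0" "d \<le> T" using t assms unfolding d_def by auto
    have "(x has_vector_derivative g t - (k / d) *\<^sub>R x t) (at t)"
      using ode[of t] t at_within_Icc_at[of 0 t s] by (simp add: d_def)
    then have V': "((\<lambda>t. x t \<bullet> x t) has_real_derivative 2 * (x t \<bullet> (g t - (k / d) *\<^sub>R x t))) (at t)"
      unfolding has_vector_derivative_def has_field_derivative_def
      by (auto intro!: derivative_eq_intros simp: inner_commute algebra_simps fun_eq_iff)
    have d': "((\<lambda>t. (T - t) ^ 4) has_real_derivative - (4 * d ^ 3)) (at t)"
      unfolding d_def by (auto intro!: derivative_eq_intros)
    have "(p * d ^ 4 - q * - (4 * d ^ 3)) / (d ^ 4 * d ^ 4) = p / d ^ 4 + 4 * q / d ^ 5" for p q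
      using d by (simp add: field_simps power_numeral_reduce)
    then have W': "(W has_real_derivative
        2 * (x t \<bullet> (g t - (k / d) *\<^sub>R x t)) / d ^ 4 + 4 * (x t \<bullet> x t) / d ^ 5) (at t)"
      using DERIV_divide[OF V' d'] d unfolding W_def d_def by simp
    have "x t \<bullet> g t \<le> norm (x t) * norm (g t)" by (rule norm_cauchy_schwarz)
    also have "\<dots> \<le> norm (x t) * (L * norm (x t))"
      using g[of t] t by (intro mult_left_mono) auto
    also have "\<dots> = L * (x t \<bullet> x t)" by (simp add: dot_square_norm power2_eq_square)
    finally have xg: "d * (x t \<bullet> g t) \<le> d * (L * (x t \<bullet> x t))"
      using d by (intro mult_left_mono) auto
    have "(L * d + 2) * (x t \<bullet> x t) \<le> k * (x t \<bullet> x t)"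
      using k d \<open>L \<ge> 0\<close> mult_left_mono[of d T L] by (intro mult_right_mono) auto
    then have "d * (x t \<bullet> g t) - k * (x t \<bullet> x t) + 2 * (x t \<bullet> x t) \<le> 0"
      using xg by (simp add: algebra_simps)
    moreover have "2 * (x t \<bullet> (g t - (k / d) *\<^sub>R x t)) / d ^ 4 + 4 * (x t \<bullet> x t) / d ^ 5
      = 2 * (d * (x t \<bullet> g t) - k * (x t \<bullet> x t) + 2 * (x t \<bullet> x t)) / d ^ 5"
      using d by (simp add: inner_diff_right field_simps power_numeral_reduce)
    ultimately have "2 * (x t \<bullet> (g t - (k / d) *\<^sub>R x t)) / d ^ 4 + 4 * (x t \<bullet> x t) / d ^ 5 \<le> 0"
      using d by (simp add: divide_nonpos_pos)
    with W' show "\<exists>y. (W has_real_derivative y) (at t) \<and> y \<le> 0" by blast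
  qed
  then have "(norm (x s))\<^sup>2 \<le> ((T - s) / T) ^ 4 * (norm (x 0))\<^sup>2"
    using \<open>s < T\<close> T by (simp add: W_def dot_square_norm field_simps)
  also have "\<dots> = (((T - s) / T)\<^sup>2 * norm (x 0))\<^sup>2"
    by (simp add: power_mult_distrib flip: power_mult)
  finally show ?thesis by (rule power2_le_imp_le) simp
qed

text \<open>
  The growth bound on \<open>f\<close> is only available inside the ball, so leaving it must be excluded. Up to a
  first time \<open>m\<close> at which \<open>|x| \<ge> \<mu>\<close>, the decay estimate applies and gives \<open>|x| \<le> |x(0)| < \<mu>\<close>, and
  this bound passes to \<open>m\<close> by continuity.
\<close>

lemma trapped_quadratic_decay:
  fixes f :: "'a::euclidean_space \<Rightarrow> 'a"
  assumes k: "k \<ge> L * T + 2" and L: "L \<ge> 0"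
    and ode: "\<And>t. t \<in> {0..<T} \<Longrightarrow>
      (x has_vector_derivative f (x t) - (k / (T - t)) *\<^sub>R x t) (at t within {0..<T})"
    and f: "\<And>a. norm a \<le> \<mu> \<Longrightarrow> norm (f a) \<le> L * norm a"
    and x0: "norm (x 0) < \<mu>" and s: "s \<in> {0..<T}"
  shows "norm (x s) \<le> ((T - s) / T)\<^sup>2 * norm (x 0)"
proof -
  have cont: "continuous_on {0..<T} x"
    using ode by (rule continuous_on_vector_derivative)
  have decay: "norm (x s) \<le> ((T - s) / T)\<^sup>2 * norm (x 0)"
    if "s \<in> {0..<T}" and "\<And>t. t \<in> {0..s} \<Longrightarrow> norm (x t) \<le> \<mu>" for s
    using that k L
    by (intro quadratic_decay[where L = L and k = k and g = "\<lambda>t. f (x t)"] f)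
      (auto intro: has_vector_derivative_within_subset[OF ode])
  have "norm (x s) < \<mu>" if s: "s \<in> {0..<T}" for s
  proof (rule ccontr)
    assume "\<not> norm (x s) < \<mu>"
    define E where "E = {0..s} \<inter> (\<lambda>t. norm (x t)) -` {\<mu>..}"
    have "closed E"
      unfolding E_def using s
      by (intro continuous_closed_preimage continuous_intros continuous_on_subset[OF cont]) auto
    then have "compact E"
      unfolding E_def by (simp add: compact_eq_bounded_closed bounded_Int)
    moreover have "s \<in> E" using \<open>\<not> _\<close> s by (simp add: E_def)
    ultimately obtain m where m: "m \<in> E" and least: "\<And>t. t \<in> E \<Longrightarrow> m \<le> t"
      using compact_attains_inf[of E] by blast
    have below: "norm (x t) < \<mu>" if "t \<in> {0..<m}" for t
      using that m least[of t] by (force simp: E_def)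
    have mT: "m \<in> {0..<T}" "m > 0" "norm (x m) \<ge> \<mu>"
      using m s x0 by (auto simp: E_def order_less_le)
    have "norm (x t) \<le> norm (x 0)" if "t \<in> {0..<m}" for t
    proof -
      have "norm (x t) \<le> ((T - t) / T)\<^sup>2 * norm (x 0)"
        using that mT below by (intro decay) (auto intro: less_imp_le)
      also have "\<dots> \<le> norm (x 0)"
        using that mT by (intro mult_left_le_one_le power_le_one) auto
      finally show ?thesis .
    qed
    moreover have "closure {0..<m} = {0..m}"
      using mT by simp
    moreover have "continuous_on {0..m} (\<lambda>t. norm (x t))"
      using mT by (intro continuous_on_norm continuous_on_subset[OF cont]) auto
    ultimately have "norm (x m) \<le> norm (x 0)"
      using continuous_le_on_closure[of "{0..<m}" "\<lambda>t. norm (x t)" m "norm (x 0)"] mT(2) by simp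
    then show False using x0 mT(3) by linarith
  qed
  then have "norm (x t) \<le> \<mu>" if "t \<in> {0..s}" for t
    using that s by (meson atLeastAtMost_iff atLeastLessThan_iff le_less_trans less_imp_le)
  then show ?thesis by (rule decay[OF s])
qed

section \<open>The closed loop\<close>

text \<open>
  The projection onto the ball extends the local Lipschitz bound on \<open>f\<close> to the whole space, and the time
  change \<open>\<sigma>(t) = ln (T/(T - t))\<close> removes the singularity at \<open>T\<close>. The resulting solution obeys the decay
  estimate, hence stays in the ball, where the projection is the identity.
\<close>

lemma singular_feedback_solution_exists:
  fixes f :: "'a::euclidean_space \<Rightarrow> 'a"
  assumes T: "T > 0" and k: "k \<ge> L * T + 2" and L: "L \<ge> 0" and "f 0 = 0"
    and lip: "\<And>a b. \<lbrakk>a \<in> cball 0 \<mu>; b \<in> cball 0 \<mu>\<rbrakk> \<Longrightarrow> norm (f a - f b) \<le> L * norm (a - b)"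
    and x0: "norm x0 < \<mu>"
  obtains x where "x 0 = x0"
    and "\<And>t. t \<in> {0..<T} \<Longrightarrow>
      (x has_vector_derivative f (x t) - (k / (T - t)) *\<^sub>R x t) (at t within {0..<T})"
proof -
  have \<mu>: "\<mu> > 0" using x0 norm_ge_zero[of x0] by linarith
  have k0: "k \<ge> 0" using k L T by (meson add_nonneg_nonneg mult_nonneg_nonneg order_trans less_imp_le zero_le_numeral)
  define \<pi> where "\<pi> = closest_point (cball (0::'a) \<mu>)"
  have \<pi>_in: "\<pi> a \<in> cball 0 \<mu>" for a
    unfolding \<pi>_def using \<mu> by (intro closest_point_in_set) auto
  have \<pi>_id: "\<pi> a = a" if "norm a \<le> \<mu>" for a
    unfolding \<pi>_def using that by (intro closest_point_self) simp
  have \<pi>_lip: "norm (\<pi> a - \<pi> b) \<le> norm (a - b)" for a b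
    unfolding \<pi>_def dist_norm[symmetric] using \<mu> by (intro closest_point_lipschitz) auto
  define g where "g a = f (\<pi> a)" for a
  have g_lip: "norm (g a - g b) \<le> L * norm (a - b)" for a b
    unfolding g_def using lip[OF \<pi>_in \<pi>_in, of a b] mult_left_mono[OF \<pi>_lip[of a b] L] by linarith
  have g_eq: "g a = f a" if "norm a \<le> \<mu>" for a
    using \<pi>_id[OF that] by (simp add: g_def)
  have g_0: "g 0 = 0" using g_eq[of 0] \<mu> \<open>f 0 = 0\<close> by simp
  have g_cont: "continuous_on UNIV g"
    using g_lip L by (intro lipschitz_on_continuous_on[of L] lipschitz_onI) (auto simp: dist_norm)
  \<comment> \<open>The equation \<open>x' = g(x) - k/(T - t) x\<close> multiplied by \<open>dt/ds = T - t = T exp(-s)\<close>.\<close>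
  define h where "h s a = (T * exp (- s)) *\<^sub>R g a - k *\<^sub>R a" for s a
  obtain \<xi> where \<xi>0: "\<xi> 0 = x0"
    and \<xi>: "\<And>s. s \<ge> 0 \<Longrightarrow> (\<xi> has_vector_derivative h s (\<xi> s)) (at s within {0..})"
  proof (rule picard_lindelof_half_line[where h = h and L = "T * L + k"])
    show "T * L + k \<ge> 0" using T L k0 by simp
    show "continuous_on {0..} (\<lambda>s. h s (z s))" if "continuous_on {0..} z" for z
      unfolding h_def using that
      by (intro continuous_intros continuous_on_compose2[OF g_cont]) auto
    show "h s 0 = 0" for s by (simp add: h_def g_0)
    show "norm (h s a - h s b) \<le> (T * L + k) * norm (a - b)" if "s \<ge> 0" for s a b
    proof -
      have "h s a - h s b = (T * exp (- s)) *\<^sub>R (g a - g b) - k *\<^sub>R (a - b)"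
        by (simp add: h_def algebra_simps)
      then have "norm (h s a - h s b) \<le> (T * exp (- s)) * norm (g a - g b) + k * norm (a - b)"
        using norm_triangle_ineq4[of "(T * exp (- s)) *\<^sub>R (g a - g b)" "k *\<^sub>R (a - b)"] T k0
        by (simp add: abs_mult)
      also have "(T * exp (- s)) * norm (g a - g b) \<le> (T * 1) * (L * norm (a - b))"
        using that T by (intro mult_mono g_lip) auto
      finally show ?thesis by (simp add: algebra_simps)
    qed
  qed blast
  define \<sigma> where "\<sigma> t = ln T - ln (T - t)" for t
  define x where "x = \<xi> \<circ> \<sigma>"
  have x_0: "x 0 = x0" using T by (simp add: x_def \<sigma>_def \<xi>0)
  have ode: "(x has_vector_derivative g (x t) - (k / (T - t)) *\<^sub>R x t) (at t within {0..<T})"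
    if t: "t \<in> {0..<T}" for t
  proof -
    have "(\<sigma> has_real_derivative 1 / (T - t)) (at t)"
      unfolding \<sigma>_def using t by (auto intro!: derivative_eq_intros)
    then have \<sigma>': "(\<sigma> has_vector_derivative 1 / (T - t)) (at t within {0..<T})"
      by (simp add: has_real_derivative_iff_has_vector_derivative has_vector_derivative_at_within)
    have \<sigma>_nonneg: "\<sigma> t \<ge> 0" if "t \<in> {0..<T}" for t
      using that by (simp add: \<sigma>_def)
    then have "(x has_vector_derivative (1 / (T - t)) *\<^sub>R h (\<sigma> t) (\<xi> (\<sigma> t))) (at t within {0..<T})"
      unfolding x_def using t
      by (intro vector_diff_chain_within \<sigma>' has_vector_derivative_within_subset[OF \<xi>]) auto
    moreover have "exp (- \<sigma> t) = (T - t) / T"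
      using t by (simp add: \<sigma>_def exp_diff)
    ultimately show ?thesis
      using t by (simp add: h_def x_def scaleR_diff_right)
  qed
  have "norm (x t) \<le> \<mu>" if t: "t \<in> {0..<T}" for t
  proof -
    have "norm (x t) \<le> ((T - t) / T)\<^sup>2 * norm (x 0)"
      using ode t x0 x_0 g_lip[of _ 0] g_0
      by (intro trapped_quadratic_decay[OF k L, where f = g and \<mu> = \<mu>]) auto
    also have "\<dots> \<le> norm (x 0)"
      using t by (intro mult_left_le_one_le power_le_one) auto
    finally show ?thesis using x0 x_0 by simp
  qed
  then have "(x has_vector_derivative f (x t) - (k / (T - t)) *\<^sub>R x t) (at t within {0..<T})"
    if "t \<in> {0..<T}" for t
    using ode[OF that] that by (simp add: g_eq)
  with x_0 show thesis by (rule that)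
qed

text \<open>
  Quadratic decay of the state outweighs the simple pole of the gain: the control is \<open>O(T - t)\<close>.
\<close>

lemma feedback_law_bounded_continuous:
  fixes K :: "real ^ 'n ^ 'm"
  assumes T: "T > 0" and cont: "continuous_on {0..<T} x"
    and decay: "\<And>t. t \<in> {0..<T} \<Longrightarrow> norm (x t) \<le> ((T - t) / T)\<^sup>2 * M"
  shows "bounded_continuous_upto T (\<lambda>t. feedback_law K \<omega> T (x t) t)" and "(x \<longlongrightarrow> 0) (at_left T)"
proof -
  have near: "\<forall>\<^sub>F t in at_left T. t \<in> {0..<T}"
    by (rule eventually_mono[OF eventually_at_left_real[OF T]]) simp
  show "(x \<longlongrightarrow> 0) (at_left T)"
  proof (rule Lim_null_comparison)
    show "\<forall>\<^sub>F t in at_left T. norm (x t) \<le> ((T - t) / T)\<^sup>2 * M"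
      by (rule eventually_mono[OF near decay])
    have "((\<lambda>t. ((T - t) / T)\<^sup>2 * M) \<longlongrightarrow> ((T - T) / T)\<^sup>2 * M) (at_left T)"
      using T by (intro tendsto_intros) auto
    then show "((\<lambda>t. ((T - t) / T)\<^sup>2 * M) \<longlongrightarrow> 0) (at_left T)" by simp
  qed
  define C where "C = onorm ((*v) K) * M / (\<bar>\<omega>\<bar> * T\<^sup>2)"
  have u: "norm (feedback_law K \<omega> T (x t) t) \<le> C * (T - t)" if t: "t \<in> {0..<T}" for t
  proof -
    have "norm (K *v x t) \<le> onorm ((*v) K) * norm (x t)"
      by (intro onorm matrix_vector_mul_bounded_linear)
    also have "\<dots> \<le> onorm ((*v) K) * (((T - t) / T)\<^sup>2 * M)"
      using decay[OF t] by (intro mult_left_mono onorm_pos_le matrix_vector_mul_bounded_linear)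
    finally have "norm (K *v x t) / ((T - t) * \<bar>\<omega>\<bar>)
        \<le> onorm ((*v) K) * (((T - t) / T)\<^sup>2 * M) / ((T - t) * \<bar>\<omega>\<bar>)"
      using t by (intro divide_right_mono) auto
    also have "\<dots> = C * (T - t)"
      using t unfolding C_def by (simp add: power_divide power2_eq_square mult_ac)
    finally show ?thesis using t by (simp add: feedback_law_def abs_mult)
  qed
  have "bounded ((\<lambda>t. feedback_law K \<omega> T (x t) t) ` {0..<T})"
    unfolding bounded_iff
  proof (intro exI[of _ "\<bar>C\<bar> * T"] ballI)
    fix y assume "y \<in> (\<lambda>t. feedback_law K \<omega> T (x t) t) ` {0..<T}"
    then obtain t where t: "t \<in> {0..<T}" "y = feedback_law K \<omega> T (x t) t" by blast
    have "C * (T - t) \<le> \<bar>C\<bar> * T" using t by (intro mult_mono) auto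
    then show "norm y \<le> \<bar>C\<bar> * T" using u t by force
  qed
  moreover have "continuous_on {0..<T} (\<lambda>t. feedback_law K \<omega> T (x t) t)"
    unfolding feedback_law_def
    by (intro continuous_intros cont bounded_linear.continuous_on[OF matrix_vector_mul_bounded_linear]) auto
  moreover have "((\<lambda>t. feedback_law K \<omega> T (x t) t) \<longlongrightarrow> 0) (at_left T)"
  proof (rule Lim_null_comparison)
    show "\<forall>\<^sub>F t in at_left T. norm (feedback_law K \<omega> T (x t) t) \<le> C * (T - t)"
      by (rule eventually_mono[OF near u])
    have "((\<lambda>t. C * (T - t)) \<longlongrightarrow> C * (T - T)) (at_left T)" by (intro tendsto_intros)
    then show "((\<lambda>t. C * (T - t)) \<longlongrightarrow> 0) (at_left T)" by simp
  qed
  ultimately show "bounded_continuous_upto T (\<lambda>t. feedback_law K \<omega> T (x t) t)"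
    unfolding bounded_continuous_upto_def by blast
qed

text \<open>
  The factor \<open>T \<omega> exp(-\<omega> \<tau>)\<close> lies between \<open>0\<close> and \<open>T \<omega>\<close>, and the remainder \<open>f(a) - Aa\<close> is at most
  \<open>(L + \<parallel>A\<parallel>) |a|\<close>; the hypothesis on \<open>\<Gamma>\<close> collects these contributions and that of \<open>Aa\<close>.
\<close>

lemma admissible_radius_linear_bound:
  fixes f :: "real ^ 'n \<Rightarrow> real ^ 'n"
  assumes "f 0 = 0" "T > 0" "\<omega> > 0" "\<mu> > 0" "L \<ge> 0"
    and f: "\<And>a. norm a \<le> \<mu> \<Longrightarrow> norm (f a) \<le> L * norm a"
    and \<Gamma>: "\<Gamma> \<ge> T * \<omega> * (L + onorm (\<lambda>a. jacobian f (at 0) *v a)) + onorm (\<lambda>a. jacobian f (at 0) *v a)"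
  shows "admissible_radius f T \<Gamma> \<omega> \<mu>"
  unfolding admissible_radius_def
proof (intro conjI allI impI)
  fix a :: "real ^ 'n" and \<tau> :: real assume a: "norm a \<le> \<mu>" and "\<tau> \<ge> 0"
  define A where "A = jacobian f (at 0)"
  define N where "N = onorm (\<lambda>a. A *v a)"
  define e where "e = T * \<omega> * exp (- \<omega> * \<tau>)"
  have e: "0 \<le> e" "e \<le> T * \<omega>"
    using assms \<open>\<tau> \<ge> 0\<close> unfolding e_def by (auto intro!: mult_left_le)
  have Aa: "norm (A *v a) \<le> N * norm a"
    unfolding N_def by (intro onorm matrix_vector_mul_bounded_linear)
  then have R: "norm (taylor_remainder f a) \<le> (L + N) * norm a"
    using f[OF a] norm_triangle_ineq4[of "f a" "A *v a"] \<open>f 0 = 0\<close>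
    by (simp add: taylor_remainder_def A_def algebra_simps)
  have "norm (e *\<^sub>R taylor_remainder f a - A *v a) \<le> e * norm (taylor_remainder f a) + norm (A *v a)"
    using norm_triangle_ineq4[of "e *\<^sub>R taylor_remainder f a" "A *v a"] e by simp
  also have "\<dots> \<le> T * \<omega> * ((L + N) * norm a) + N * norm a"
    using e by (intro add_mono mult_mono R Aa) auto
  also have "\<dots> = (T * \<omega> * (L + N) + N) * norm a" by (simp add: algebra_simps)
  also have "\<dots> \<le> \<Gamma> * norm a"
    using \<Gamma> by (intro mult_right_mono) (auto simp: N_def A_def)
  finally show "norm ((T * \<omega> * exp (- \<omega> * \<tau>)) *\<^sub>R taylor_remainder f a - jacobian f (at 0) *v a) \<le> \<Gamma> * norm a"
    by (simp add: e_def A_def)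
qed (use assms in simp)

theorem theorem6p1:
  fixes f :: "real ^ 'n \<Rightarrow> real ^ 'n" and B :: "real ^ 'n ^ 'n" and T \<mu> :: real
  assumes "C2 f" and "f 0 = 0"
    and "bounded_second_partials f"
    and "invertible B"
    and "T > 0" and "\<mu> > 0"
    and "trajectories_exist f B T"
  shows "\<exists>\<Gamma>\<^sub>0 \<omega>. \<Gamma>\<^sub>0 > onorm (\<lambda>a. jacobian f (at 0) *v a) \<and> \<omega> > 0 \<and>
           admissible_radius f T \<Gamma>\<^sub>0 \<omega> \<mu> \<and>
           (\<exists>K :: real ^ 'n ^ 'n. \<forall>x0. norm x0 < \<mu> \<longrightarrow>
              (\<exists>x. closed_loop_solution f B K \<omega> T x0 x) \<and>
              (\<forall>x. closed_loop_solution f B K \<omega> T x0 x \<longrightarrow>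
                 bounded_continuous_upto T (\<lambda>t. feedback_law K \<omega> T (x t) t) \<and>
                 (x \<longlongrightarrow> 0) (at_left T)))"
proof -
  obtain L where L: "L \<ge> 0" and
    lip: "\<And>a b. \<lbrakk>a \<in> cball 0 \<mu>; b \<in> cball 0 \<mu>\<rbrakk> \<Longrightarrow> norm (f a - f b) \<le> L * norm (a - b)"
    using C1_lipschitz_on_cball \<open>C2 f\<close> unfolding C2_def by metis
  have f: "norm (f a) \<le> L * norm a" if "norm a \<le> \<mu>" for a
    using lip[of a 0] that \<open>\<mu> > 0\<close> \<open>f 0 = 0\<close> by simp
  obtain C where C: "B ** C = mat 1"
    using \<open>invertible B\<close> unfolding invertible_def by blast
  define k where "k = L * T + 2"
  define K where "K = (- k) *\<^sub>R C"
  have closed_loop: "closed_loop_solution f B K 1 T x0 x \<longleftrightarrow> x 0 = x0 \<and> (\<forall>t\<in>{0..<T}.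
      (x has_vector_derivative f (x t) - (k / (T - t)) *\<^sub>R x t) (at t within {0..<T}))" for x0 x
  proof -
    have "K *v a = (- k) *\<^sub>R (C *v a)" for a
      by (simp only: K_def scaleR_matrix_vector_assoc)
    then have "B *v (K *v a) = (- k) *\<^sub>R a" for a
      by (simp only: matrix_vector_mult_scaleR matrix_vector_mul_assoc C matrix_vector_mul_lid)
    then have "B *v feedback_law K 1 T a t = - ((k / (T - t)) *\<^sub>R a)" for a t
      by (simp add: feedback_law_def matrix_vector_mult_scaleR)
    then show ?thesis by (simp add: closed_loop_solution_def solves_on_def)
  qed
  define N where "N = onorm (\<lambda>a. jacobian f (at 0) *v a)"
  have N: "N \<ge> 0" unfolding N_def by (intro onorm_pos_le matrix_vector_mul_bounded_linear)
  \<comment> \<open>The summand \<open>1\<close> makes the inequality \<open>\<Gamma>\<^sub>0 > \<parallel>A\<parallel>\<close> strict.\<close>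
  define \<Gamma> where "\<Gamma> = T * (L + N) + N + 1"
  have "T * (L + N) \<ge> 0" using L N \<open>T > 0\<close> by simp
  then have "\<Gamma> > N" by (simp add: \<Gamma>_def)
  moreover have "admissible_radius f T \<Gamma> 1 \<mu>"
    using assms L f by (intro admissible_radius_linear_bound[where L = L]) (auto simp: \<Gamma>_def N_def)
  moreover have "(\<exists>x. closed_loop_solution f B K 1 T x0 x) \<and>
      (\<forall>x. closed_loop_solution f B K 1 T x0 x \<longrightarrow>
        bounded_continuous_upto T (\<lambda>t. feedback_law K 1 T (x t) t) \<and> (x \<longlongrightarrow> 0) (at_left T))"
    if x0: "norm x0 < \<mu>" for x0
  proof (intro conjI allI impI)
    show "\<exists>x. closed_loop_solution f B K 1 T x0 x"
      using singular_feedback_solution_exists[OF \<open>T > 0\<close> _ L \<open>f 0 = 0\<close> lip x0, of k]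
      unfolding closed_loop k_def by (metis order_refl)
  next
    fix x assume "closed_loop_solution f B K 1 T x0 x"
    then have x: "x 0 = x0" and ode: "\<And>t. t \<in> {0..<T} \<Longrightarrow>
        (x has_vector_derivative f (x t) - (k / (T - t)) *\<^sub>R x t) (at t within {0..<T})"
      unfolding closed_loop by auto
    have decay: "norm (x t) \<le> ((T - t) / T)\<^sup>2 * norm (x 0)" if "t \<in> {0..<T}" for t
      using that x x0 f L ode
      by (intro trapped_quadratic_decay[where f = f and k = k and L = L and \<mu> = \<mu>]) (auto simp: k_def)
    have cont: "continuous_on {0..<T} x"
      using ode by (rule continuous_on_vector_derivative)
    show "bounded_continuous_upto T (\<lambda>t. feedback_law K 1 T (x t) t)" "(x \<longlongrightarrow> 0) (at_left T)"
      using feedback_law_bounded_continuous[OF \<open>T > 0\<close> cont decay] by auto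
  qed
  ultimately show ?thesis unfolding N_def by (intro exI[of _ \<Gamma>] exI[of _ 1] exI[of _ K] conjI) auto
qed

end
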